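(* Let $\mathcal I$ be an ideal on $\mathbb N$, and let $A$ and $B$ be infinite subsets of $\mathbb N$ with $A\subseteq B$ and $A\notin\mathcal I$. If $\mathcal I\restriction B$ is complemented in $B$, then $\mathcal I\restriction A$ is complemented in $A$. In particular, if $\mathcal I$ is complemented, then $\mathcal I\restriction A$ is complemented in $A$ for every $A\subseteq\mathbb N$ with $A\notin\mathcal I$.
   Context: An ideal on a set $X$ is a family of subsets of $X$ containing $\emptyset$ and closed under subsets and finite unions; every ideal is assumed to contain all finite subsets of $X$. For $A\subseteq\mathbb N$, $\mathcal I\restriction A=\{A\cap C:C\in\mathcal I\}$, an ideal on $A$. For an ideal $\mathcal K$ on a countable set $X$, $\ell_\infty(X)$ is the Banach space of bounded scalar families $(x_n)_{n\in X}$ with sup norm, and $c_{0,\mathcal K}$ is its closed subspace of all $(x_n)_{n\in X}$ with $\{n\in X:|x_n|\ge\varepsilon\}\in\mathcal K$ for every $\varepsilon>0$. A proper ideal $\mathcal K$ on $X\subseteq\mathbb N$ is complemented in $X$ if $c_{0,\mathcal K}$ is complemented in $\ell_\infty(X)$ (i.e. is the range of a bounded linear projection on $\ell_\infty(X)$); "complemented" for an ideal on $\mathbb N$ means complemented in $\mathbb N$. *)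

theory Defs
  imports "HOL-Analysis.Analysis"
begin

definition ideal_on :: "'i set \<Rightarrow> 'i set set \<Rightarrow> bool" where
  "ideal_on X K \<longleftrightarrow>
     K \<subseteq> Pow X \<and> {} \<in> K \<and>
     (\<forall>C\<in>K. \<forall>D. D \<subseteq> C \<longrightarrow> D \<in> K) \<and>
     (\<forall>C\<in>K. \<forall>D\<in>K. C \<union> D \<in> K) \<and>
     (\<forall>F. finite F \<and> F \<subseteq> X \<longrightarrow> F \<in> K)"

definition ideal_restrict :: "'i set set \<Rightarrow> 'i set \<Rightarrow> 'i set set" where
  "ideal_restrict I A = {A \<inter> C | C. C \<in> I}"

(* The scalars are an arbitrary complete real normed field (with multiplicative norm); up to
   isometric isomorphism these are exactly the real and the complex numbers, so a statement for
   all such 's covers both the real and the complex theory.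
   A family indexed by X is represented by its extension by zero to the whole index type. *)

definition linf :: "'i set \<Rightarrow> ('i \<Rightarrow> 's::{real_normed_field,banach}) set" where
  "linf X = {x. (\<forall>n. n \<notin> X \<longrightarrow> x n = 0) \<and> bounded (x ` X)}"

(* The supremum is junk for X = {}; this case cannot occur for a proper ideal on X. *)
definition linf_norm :: "'i set \<Rightarrow> ('i \<Rightarrow> 's::{real_normed_field,banach}) \<Rightarrow> real" where
  "linf_norm X x = (SUP n\<in>X. norm (x n))"

definition c0_ideal :: "'i set \<Rightarrow> 'i set set \<Rightarrow> ('i \<Rightarrow> 's::{real_normed_field,banach}) set" where
  "c0_ideal X K = {x \<in> linf X. \<forall>\<epsilon>>0. {n \<in> X. norm (x n) \<ge> \<epsilon>} \<in> K}"

(* Linearity is over the scalar field 's (complex linearity for complex scalars), so the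
   library's bounded_linear, which is real linearity on a whole type, does not apply.
   Values of P outside linf X are irrelevant. *)
definition bounded_operator_linf ::
    "'i set \<Rightarrow> (('i \<Rightarrow> 's::{real_normed_field,banach}) \<Rightarrow> ('i \<Rightarrow> 's)) \<Rightarrow> bool" where
  "bounded_operator_linf X P \<longleftrightarrow>
     (\<forall>x\<in>linf X. P x \<in> linf X) \<and>
     (\<forall>x\<in>linf X. \<forall>y\<in>linf X. P (\<lambda>n. x n + y n) = (\<lambda>n. P x n + P y n)) \<and>
     (\<forall>c. \<forall>x\<in>linf X. P (\<lambda>n. c * x n) = (\<lambda>n. c * P x n)) \<and>
     (\<exists>M. \<forall>x\<in>linf X. linf_norm X (P x) \<le> M * linf_norm X x)"

definition complemented_in_linf :: "'i set \<Rightarrow> ('i \<Rightarrow> 's::{real_normed_field,banach}) set \<Rightarrow> bool" where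
  "complemented_in_linf X Y \<longleftrightarrow>
     (\<exists>P. bounded_operator_linf X P \<and> (\<forall>x\<in>linf X. P (P x) = P x) \<and> P ` linf X = Y)"

(* The first argument only carries the scalar field, which is not determined by X and K. *)
definition complemented_ideal ::
    "'s::{real_normed_field,banach} itself \<Rightarrow> 'i set \<Rightarrow> 'i set set \<Rightarrow> bool" where
  "complemented_ideal _ X K \<longleftrightarrow>
     ideal_on X K \<and> X \<notin> K \<and> complemented_in_linf X (c0_ideal X K :: ('i \<Rightarrow> 's) set)"

end

theory Submission
  imports Defs
begin

text \<open>
  Families are extended by zero, so \<open>linf A\<close> is literally a subspace of \<open>linf X\<close> whenever
  \<open>A \<subseteq> X\<close>, and, for \<open>A \<noteq> {}\<close>, with the same norm. Likewise the null families along the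
  restricted ideal are exactly the null families along \<open>K\<close> that vanish outside \<open>A\<close>, and cutting
  a null family along \<open>K\<close> down to \<open>A\<close> yields one of these. Hence, if \<open>P\<close> is a bounded projection
  of \<open>linf X\<close> onto the null families along \<open>K\<close>, then
  \<open>linf A \<subseteq> linf X \<rightarrow> linf X \<rightarrow> linf A\<close>, that is, inclusion, \<open>P\<close>, multiplication by the
  indicator of \<open>A\<close>, is a bounded operator with values in the null families along the restricted
  ideal, and it fixes these because \<open>P\<close> does. It is the required projection.

  Since restricting to \<open>B\<close> and then to \<open>A \<subseteq> B\<close> is the same as restricting to \<open>A\<close>, both claims
  about an ideal on \<open>\<nat>\<close> are instances of this one construction.
\<close>

definition cut_to :: "'i set \<Rightarrow> ('i \<Rightarrow> 's::zero) \<Rightarrow> 'i \<Rightarrow> 's" where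
  "cut_to A x = (\<lambda>n. if n \<in> A then x n else 0)"

lemma ideal_on_downward:
  "ideal_on X K \<Longrightarrow> C \<in> K \<Longrightarrow> D \<subseteq> C \<Longrightarrow> D \<in> K"
  by (simp add: ideal_on_def)

lemma mem_ideal_restrict_iff:
  assumes "ideal_on X K"
  shows "C \<in> ideal_restrict K A \<longleftrightarrow> C \<in> K \<and> C \<subseteq> A"
proof
  assume "C \<in> ideal_restrict K A"
  then obtain D where "D \<in> K" "C = A \<inter> D"
    by (auto simp: ideal_restrict_def)
  then show "C \<in> K \<and> C \<subseteq> A"
    using ideal_on_downward[OF assms, of D C] by simp
qed (auto simp: ideal_restrict_def)

lemma ideal_on_ideal_restrict:
  assumes "ideal_on X K" "A \<subseteq> X"
  shows "ideal_on A (ideal_restrict K A)"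
proof -
  have "{} \<in> K"
    and un: "C \<in> K \<Longrightarrow> D \<in> K \<Longrightarrow> C \<union> D \<in> K"
    and fin: "finite F \<Longrightarrow> F \<subseteq> X \<Longrightarrow> F \<in> K" for C D F
    using assms(1) by (simp_all add: ideal_on_def)
  show ?thesis
    unfolding ideal_on_def
  proof (intro conjI ballI allI impI)
    show "D \<in> ideal_restrict K A" if "C \<in> ideal_restrict K A" "D \<subseteq> C" for C D
      using that ideal_on_downward[OF assms(1), of C D] by (auto simp: mem_ideal_restrict_iff[OF assms(1)])
    show "F \<in> ideal_restrict K A" if "finite F \<and> F \<subseteq> A" for F
      using that fin[of F] assms(2) by (auto simp: mem_ideal_restrict_iff[OF assms(1)])
  qed (use \<open>{} \<in> K\<close> in \<open>simp_all add: mem_ideal_restrict_iff[OF assms(1)] un subset_iff\<close>)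
qed

lemma ideal_restrict_restrict:
  assumes "A \<subseteq> B"
  shows "ideal_restrict (ideal_restrict I B) A = ideal_restrict I A"
proof -
  have "A \<inter> (B \<inter> C) = A \<inter> C" for C
    using assms by blast
  moreover have "ideal_restrict (ideal_restrict I B) A = (\<lambda>C. A \<inter> (B \<inter> C)) ` I"
    by (auto simp: ideal_restrict_def)
  ultimately show ?thesis
    by (auto simp: ideal_restrict_def)
qed

lemma linf_mono:
  assumes "A \<subseteq> X"
  shows "linf A \<subseteq> linf X"
proof
  fix x :: "'a \<Rightarrow> 'b" assume x: "x \<in> linf A"
  have "x ` X \<subseteq> insert 0 (x ` A)"
    using x by (auto simp: linf_def)
  then show "x \<in> linf X"
    using x assms by (auto simp: linf_def intro: bounded_subset[of "insert 0 (x ` A)"])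
qed

lemma cut_to_in_linf:
  assumes "x \<in> linf X" "A \<subseteq> X"
  shows "cut_to A x \<in> linf A"
proof -
  have "cut_to A x ` A \<subseteq> x ` X"
    using assms(2) by (auto simp: cut_to_def)
  then show ?thesis
    using assms(1) by (auto simp: linf_def cut_to_def intro: bounded_subset)
qed

lemma norm_le_linf_norm:
  assumes "x \<in> linf X" "n \<in> X"
  shows "norm (x n) \<le> linf_norm X x"
proof -
  have "bdd_above ((\<lambda>n. norm (x n)) ` X)"
    using assms(1) by (auto simp: linf_def bounded_iff bdd_above_def)
  then show ?thesis
    unfolding linf_norm_def using assms(2) by (intro cSUP_upper)
qed

lemma linf_norm_cut_to_le:
  assumes "x \<in> linf X" "A \<subseteq> X" "A \<noteq> {}"
  shows "linf_norm A (cut_to A x) \<le> linf_norm X x"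
  unfolding linf_norm_def[of A] cut_to_def
  using assms norm_le_linf_norm[OF assms(1)] by (intro cSUP_least) auto

lemma linf_norm_extend:
  assumes "x \<in> linf A" "A \<subseteq> X" "A \<noteq> {}"
  shows "linf_norm X x = linf_norm A x"
proof (rule antisym)
  have x0: "x n = 0" if "n \<notin> A" for n
    using assms(1) that by (simp add: linf_def)
  obtain a where "a \<in> A"
    using assms(3) by blast
  then have "0 \<le> linf_norm A x"
    using norm_le_linf_norm[OF assms(1)] norm_ge_zero order_trans by blast
  then have "norm (x n) \<le> linf_norm A x" for n
    using norm_le_linf_norm[OF assms(1)] x0 by (cases "n \<in> A") auto
  then show "linf_norm X x \<le> linf_norm A x"
    unfolding linf_norm_def[of X] using assms by (intro cSUP_least) auto
  have "cut_to A x = x"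
    using x0 by (auto simp: cut_to_def)
  then show "linf_norm A x \<le> linf_norm X x"
    using linf_norm_cut_to_le[OF _ assms(2,3), of x] linf_mono[OF assms(2)] assms(1) by auto
qed

lemma cut_to_in_c0_ideal:
  assumes "ideal_on X K" "A \<subseteq> X" "x \<in> c0_ideal X K"
  shows "cut_to A x \<in> c0_ideal A (ideal_restrict K A)"
proof -
  have "{n \<in> A. \<epsilon> \<le> norm (cut_to A x n)} \<in> K" if "\<epsilon> > 0" for \<epsilon>
  proof -
    have "{n \<in> X. \<epsilon> \<le> norm (x n)} \<in> K"
      using assms(3) that by (simp add: c0_ideal_def)
    moreover have "{n \<in> A. \<epsilon> \<le> norm (cut_to A x n)} \<subseteq> {n \<in> X. \<epsilon> \<le> norm (x n)}"
      using assms(2) by (auto simp: cut_to_def)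
    ultimately show ?thesis
      by (rule ideal_on_downward[OF assms(1)])
  qed
  then show ?thesis
    using assms cut_to_in_linf[of x X A]
    by (auto simp: c0_ideal_def mem_ideal_restrict_iff[OF assms(1)])
qed

lemma c0_ideal_restrict_subset:
  assumes "ideal_on X K" "A \<subseteq> X"
  shows "c0_ideal A (ideal_restrict K A) \<subseteq> c0_ideal X K"
proof
  fix y :: "'a \<Rightarrow> 'b" assume y: "y \<in> c0_ideal A (ideal_restrict K A)"
  then have yA: "y \<in> linf A"
    by (simp add: c0_ideal_def)
  have "{n \<in> X. \<epsilon> \<le> norm (y n)} \<in> K" if "\<epsilon> > 0" for \<epsilon>
  proof -
    have "{n \<in> X. \<epsilon> \<le> norm (y n)} = {n \<in> A. \<epsilon> \<le> norm (y n)}"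
      using yA assms(2) that by (force simp: linf_def)
    then show ?thesis
      using y that by (simp add: c0_ideal_def mem_ideal_restrict_iff[OF assms(1)])
  qed
  then show "y \<in> c0_ideal X K"
    using yA linf_mono[OF assms(2)] by (auto simp: c0_ideal_def)
qed

text \<open>
  The compression of \<open>P\<close> to \<open>linf A\<close>. The norm is a genuine supremum only over a nonempty index
  set, which is why \<open>A \<noteq> {}\<close> is assumed.
\<close>

lemma bounded_operator_linf_compression:
  fixes P :: "('i \<Rightarrow> 's::{real_normed_field,banach}) \<Rightarrow> 'i \<Rightarrow> 's"
  assumes P: "bounded_operator_linf X P" and A: "A \<subseteq> X" "A \<noteq> {}"
  shows "bounded_operator_linf A (\<lambda>x. cut_to A (P x))"
proof -
  have AX: "x \<in> linf X" if "x \<in> linf A" for x :: "'i \<Rightarrow> 's"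
    using that linf_mono[OF A(1)] by blast
  have PX: "P x \<in> linf X" if "x \<in> linf A" for x
    using P AX[OF that] by (simp add: bounded_operator_linf_def)
  obtain M where M: "linf_norm X (P x) \<le> M * linf_norm X x" if "x \<in> linf X" for x
    using P unfolding bounded_operator_linf_def by blast
  have "linf_norm A (cut_to A (P x)) \<le> M * linf_norm A x" if "x \<in> linf A" for x
    using linf_norm_cut_to_le[OF PX[OF that] A] M[OF AX[OF that]] linf_norm_extend[OF that A]
    by simp
  then have "\<exists>M. \<forall>x\<in>linf A. linf_norm A (cut_to A (P x)) \<le> M * linf_norm A x"
    by blast
  moreover have "\<forall>x\<in>linf A. \<forall>y\<in>linf A. P (\<lambda>n. x n + y n) = (\<lambda>n. P x n + P y n)"
    and "\<forall>c. \<forall>x\<in>linf A. P (\<lambda>n. c * x n) = (\<lambda>n. c * P x n)"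
    using P AX by (simp_all add: bounded_operator_linf_def)
  ultimately show ?thesis
    using cut_to_in_linf[OF PX A(1)]
    by (auto simp: bounded_operator_linf_def cut_to_def fun_eq_iff)
qed

lemma complemented_ideal_restrict:
  assumes compl: "complemented_ideal TYPE('s::{real_normed_field,banach}) X K"
    and A: "A \<subseteq> X" "A \<notin> K"
  shows "complemented_ideal TYPE('s) A (ideal_restrict K A)"
proof -
  let ?c0X = "c0_ideal X K :: ('a \<Rightarrow> 's) set"
  let ?c0A = "c0_ideal A (ideal_restrict K A) :: ('a \<Rightarrow> 's) set"
  have K: "ideal_on X K"
    using compl by (simp add: complemented_ideal_def)
  then have "A \<noteq> {}"
    using A(2) by (auto simp: ideal_on_def)
  obtain P where P: "bounded_operator_linf X P"
    and idem: "\<And>x. x \<in> linf X \<Longrightarrow> P (P x) = P x" and range: "P ` linf X = ?c0X"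
    using compl unfolding complemented_ideal_def complemented_in_linf_def by auto
  define Q where "Q = (\<lambda>x. cut_to A (P x))"
  have Q_range: "Q x \<in> ?c0A" if "x \<in> linf A" for x
    unfolding Q_def using range subsetD[OF linf_mono[OF A(1)] that]
    by (intro cut_to_in_c0_ideal[OF K A(1)]) blast
  have Q_fixes: "Q y = y" if y: "y \<in> ?c0A" for y
  proof -
    have "y \<in> P ` linf X"
      using c0_ideal_restrict_subset[OF K A(1)] y range by blast
    then have "P y = y"
      using idem by auto
    moreover have "y n = 0" if "n \<notin> A" for n
      using y that by (simp add: c0_ideal_def linf_def)
    ultimately show ?thesis
      by (auto simp: Q_def cut_to_def)
  qed
  have sub: "?c0A \<subseteq> linf A"
    by (auto simp: c0_ideal_def)
  have "Q ` linf A = ?c0A"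
  proof
    show "Q ` linf A \<subseteq> ?c0A"
      using Q_range by blast
    show "?c0A \<subseteq> Q ` linf A"
      using Q_fixes sub by (metis image_eqI subset_iff)
  qed
  moreover have "bounded_operator_linf A Q"
    unfolding Q_def by (rule bounded_operator_linf_compression[OF P A(1) \<open>A \<noteq> {}\<close>])
  moreover have "\<forall>x\<in>linf A. Q (Q x) = Q x"
    using Q_range Q_fixes by blast
  ultimately have "complemented_in_linf A ?c0A"
    unfolding complemented_in_linf_def by blast
  moreover have "A \<notin> ideal_restrict K A"
    using A(2) by (simp add: mem_ideal_restrict_iff[OF K])
  ultimately show ?thesis
    using ideal_on_ideal_restrict[OF K A(1)] by (simp add: complemented_ideal_def)
qed

theorem proposition5p17:
  fixes I :: "nat set set"
  assumes "ideal_on UNIV I"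
  shows "(\<forall>A B. infinite A \<and> infinite B \<and> A \<subseteq> B \<and> A \<notin> I \<and>
            complemented_ideal TYPE('s::{real_normed_field,banach}) B (ideal_restrict I B) \<longrightarrow>
            complemented_ideal TYPE('s) A (ideal_restrict I A)) \<and>
         (complemented_ideal TYPE('s) UNIV I \<longrightarrow>
            (\<forall>A. A \<notin> I \<longrightarrow> complemented_ideal TYPE('s) A (ideal_restrict I A)))"
proof (intro conjI allI impI; (elim conjE)?)
  fix A B
  assume "A \<subseteq> B" "A \<notin> I"
    and compl: "complemented_ideal TYPE('s) B (ideal_restrict I B)"
  then have "A \<notin> ideal_restrict I B"
    by (simp add: mem_ideal_restrict_iff[OF assms])
  from complemented_ideal_restrict[OF compl \<open>A \<subseteq> B\<close> this]
  show "complemented_ideal TYPE('s) A (ideal_restrict I A)"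
    by (simp add: ideal_restrict_restrict[OF \<open>A \<subseteq> B\<close>])
next
  fix A
  assume "complemented_ideal TYPE('s) UNIV I" "A \<notin> I"
  then show "complemented_ideal TYPE('s) A (ideal_restrict I A)"
    by (intro complemented_ideal_restrict) auto
qed

end
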